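(* Let $\Gamma$ be a finitely generated discrete group with the rapid decay property with decay exponent $r>0$, equipped with a word length function $\ell$. For any natural number $k>r$, if $\mathrm{Mdim}_{L^k_\ell}(C^*_r(\Gamma))=d<+\infty$, then $\mathrm{Entp}(\mathrm{Ad}_z)=0$ for any $z\in\Gamma$, where $\mathrm{Ad}_z$ is the inner automorphism $g\mapsto zgz^{-1}$ of $\Gamma$.
   Context: $\ell$ is the word length function with respect to a fixed finite generating set. $\Gamma$ has the rapid decay property with decay exponent $r>0$ (with respect to $\ell$) if there is $C>0$ such that $\|f\|_{\mathrm{red}}\le C\big(\sum_{g\in\Gamma}|f(g)|^2(1+\ell(g))^{2r}\big)^{1/2}$ for all $f\in C_c(\Gamma)$. $C^*_r(\Gamma)$ is the reduced group $C^*$-algebra with norm $\|\cdot\|_{\mathrm{red}}$, $\lambda$ is its (left regular) representation on $\ell^2(\Gamma)$, $C_c(\Gamma)$ is the dense $*$-subalgebra of finitely supported functions $\sum c_g\delta_g$ (with convolution product), and $C_c(\Gamma)_1=\{f\in C_c(\Gamma):\|f\|_{\mathrm{red}}\le1\}$. $M_\ell$ is the unbounded operator on $\ell^2(\Gamma)$ with domain $C_c(\Gamma)$, $M_\ell(\sum c_g\delta_g)=\sum\ell(g)c_g\delta_g$. For $f\in C_c(\Gamma)$, $\Delta^1_\ell(f)=[M_\ell,\lambda(f)]$ and $\Delta^k_\ell(f)=[M_\ell,\Delta^{k-1}_\ell(f)]$; these extend to bounded operators. The seminorm $L^k_\ell:C^*_r(\Gamma)\to[0,+\infty]$ is $L^k_\ell(f)=\|\Delta^k_\ell(f)\|_{\mathrm{op}}$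 for $f\in C_c(\Gamma)$ and $+\infty$ off $C_c(\Gamma)$. (For $k>r$ the pair $(C^*_r(\Gamma),L^k_\ell)$ is a compact quantum metric space, by a known theorem of Antonescu and Christensen.) For a subset $Y$ of a normed space $X$ and $\delta>0$, $D(Y,\delta)$ is the infimum of $\dim Z$ over finite-dimensional subspaces $Z\subseteq X$ such that for every $y\in Y$ there is $z\in Z$ with $\|y-z\|<\delta$. The metric dimension is $\mathrm{Mdim}_{L}(A)=\limsup_{\delta\to0^+}\frac{\log D(\mathcal L_1,\delta)}{\log\delta^{-1}}$, where $\mathcal L_1=\{a\in A:L(a)<1\}$. An automorphism $\phi$ of $\Gamma$ induces an automorphism of $C^*_r(\Gamma)$, also denoted $\phi$, with $\phi(\sum c_g\delta_g)=\sum c_g\delta_{\phi(g)}$. Product entropy: for finite $\Omega\subseteq C_c(\Gamma)_1$ and $\delta>0$, $\mathrm{Entp}(\phi,\Omega,\delta)=\limsup_{n\to\infty}\frac1n\log D\big(\Omega\,\phi(\Omega)\cdots\phi^{n-1}(\Omega),\delta\big)$ (set of all products $a_0\cdots a_{n-1}$, $a_i\in\phi^i(\Omega)$, in $C_r^*(\Gamma)$), and $\mathrm{Entp}(\phi)=\sup_{\Omega}\sup_{\delta>0}\mathrm{Entp}(\phi,\Omega,\delta)$, with $\Omega$ ranging over finite subsets of $C_c(\Gamma)_1$. *)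

theory Defs
  imports
    "HOL-Analysis.Analysis"
    "HOL-Algebra.Generated_Groups"
    "HOL-Library.Function_Algebras"
begin

section \<open>Word length\<close>

definition word_length :: "('a, 'b) monoid_scheme \<Rightarrow> 'a set \<Rightarrow> 'a \<Rightarrow> nat" where
  "word_length G S g = (LEAST n. \<exists>ws. length ws = n \<and> set ws \<subseteq> S \<union> m_inv G ` S \<and>
     g = foldr (\<lambda>x y. x \<otimes>\<^bsub>G\<^esub> y) ws \<one>\<^bsub>G\<^esub>)"


section \<open>Finitely supported functions and square-summable functions on a group\<close>

text \<open>Functions on the group are represented as functions on the whole type vanishing
  outside the carrier.\<close>

abbreviation supp :: "('a \<Rightarrow> complex) \<Rightarrow> 'a set" where
  "supp f \<equiv> {g. f g \<noteq> 0}"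

definition Cc :: "('a, 'b) monoid_scheme \<Rightarrow> ('a \<Rightarrow> complex) set" where
  "Cc G = {f. finite (supp f) \<and> supp f \<subseteq> carrier G}"

definition delta :: "'a \<Rightarrow> 'a \<Rightarrow> complex" where
  "delta g = (\<lambda>x. if x = g then 1 else 0)"

definition ell2 :: "('a, 'b) monoid_scheme \<Rightarrow> ('a \<Rightarrow> complex) set" where
  "ell2 G = {\<xi>. supp \<xi> \<subseteq> carrier G \<and> (\<lambda>x. (cmod (\<xi> x))\<^sup>2) summable_on UNIV}"

definition ell2_norm :: "('a \<Rightarrow> complex) \<Rightarrow> real" where
  "ell2_norm \<xi> = sqrt (\<Sum>\<^sub>\<infinity>x. (cmod (\<xi> x))\<^sup>2)"


section \<open>Operators\<close>

type_synonym 'a operator = "('a \<Rightarrow> complex) \<Rightarrow> ('a \<Rightarrow> complex)"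

text \<open>Operator norm of an operator with domain \<open>V\<close> (possibly only a dense subspace of
  \<open>\<ell>\<^sup>2\<close>): the least bound on its domain, \<open>\<infinity>\<close> if unbounded.  For a bounded densely
  defined operator this is the norm of its continuous extension.\<close>

definition op_norm :: "('a \<Rightarrow> complex) set \<Rightarrow> 'a operator \<Rightarrow> ereal" where
  "op_norm V T = (SUP \<xi>\<in>{\<xi> \<in> V. ell2_norm \<xi> \<le> 1}. ereal (ell2_norm (T \<xi>)))"

text \<open>Everywhere defined operators are made canonical by the value \<open>0\<close> outside \<open>\<ell>\<^sup>2\<close>, so that
  equality of operators is equality in HOL and the operators form a complex vector space under
  the pointwise operations.\<close>

definition bounded_ops :: "('a, 'b) monoid_scheme \<Rightarrow> 'a operator set" where
  "bounded_ops G = {T.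
     (\<forall>\<xi>. \<xi> \<notin> ell2 G \<longrightarrow> T \<xi> = 0) \<and>
     (\<forall>\<xi>\<in>ell2 G. T \<xi> \<in> ell2 G) \<and>
     (\<forall>\<xi>\<in>ell2 G. \<forall>\<eta>\<in>ell2 G. T (\<xi> + \<eta>) = T \<xi> + T \<eta>) \<and>
     (\<forall>c. \<forall>\<xi>\<in>ell2 G. T (\<lambda>x. c * \<xi> x) = (\<lambda>x. c * T \<xi> x)) \<and>
     op_norm (ell2 G) T < \<infinity>}"

definition op_scale :: "complex \<Rightarrow> 'a operator \<Rightarrow> 'a operator" where
  "op_scale c T = (\<lambda>\<xi> x. c * T \<xi> x)"

global_interpretation op: vector_space op_scale
  by unfold_locales (auto simp: op_scale_def fun_eq_iff algebra_simps)


section \<open>The reduced group C*-algebra\<close>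

text \<open>Left regular representation: \<open>(\<lambda>(f) \<xi>)(h) = \<Sum>\<^sub>g f(g) \<xi>(g\<^sup>-\<^sup>1 h)\<close>.\<close>

definition lreg :: "('a, 'b) monoid_scheme \<Rightarrow> ('a \<Rightarrow> complex) \<Rightarrow> 'a operator" where
  "lreg G f = (\<lambda>\<xi> h. if \<xi> \<in> ell2 G \<and> h \<in> carrier G
     then \<Sum>g\<in>supp f. f g * \<xi> (inv\<^bsub>G\<^esub> g \<otimes>\<^bsub>G\<^esub> h) else 0)"

definition red_norm :: "('a, 'b) monoid_scheme \<Rightarrow> ('a \<Rightarrow> complex) \<Rightarrow> ereal" where
  "red_norm G f = op_norm (ell2 G) (lreg G f)"

definition Cstar_red :: "('a, 'b) monoid_scheme \<Rightarrow> 'a operator set" where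
  "Cstar_red G = {T \<in> bounded_ops G.
     \<forall>\<epsilon>>0. \<exists>f\<in>Cc G. op_norm (ell2 G) (T - lreg G f) < ereal \<epsilon>}"

definition Cc_ball :: "('a, 'b) monoid_scheme \<Rightarrow> ('a \<Rightarrow> complex) set" where
  "Cc_ball G = {f \<in> Cc G. red_norm G f \<le> 1}"

definition rapid_decay :: "('a, 'b) monoid_scheme \<Rightarrow> 'a set \<Rightarrow> real \<Rightarrow> bool" where
  "rapid_decay G S r \<longleftrightarrow> (\<exists>C>0. \<forall>f\<in>Cc G. red_norm G f \<le>
     ereal (C * sqrt (\<Sum>g\<in>supp f. (cmod (f g))\<^sup>2 * (1 + real (word_length G S g)) powr (2 * r))))"


section \<open>The seminorms from iterated commutators\<close>

definition mult_length :: "('a, 'b) monoid_scheme \<Rightarrow> 'a set \<Rightarrow> 'a operator" where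
  "mult_length G S \<xi> = (\<lambda>g. of_nat (word_length G S g) * \<xi> g)"

definition commutator :: "'a operator \<Rightarrow> 'a operator \<Rightarrow> 'a operator" where
  "commutator A B = (\<lambda>\<xi>. A (B \<xi>) - B (A \<xi>))"

text \<open>The iterated commutators are only considered on the domain \<open>Cc G\<close> of the unbounded
  operator \<open>mult_length G S\<close>.\<close>

definition comm_seminorm :: "('a, 'b) monoid_scheme \<Rightarrow> 'a set \<Rightarrow> nat \<Rightarrow> 'a operator \<Rightarrow> ereal" where
  "comm_seminorm G S k a =
     (if a \<in> lreg G ` Cc G then op_norm (Cc G) ((commutator (mult_length G S) ^^ k) a) else \<infinity>)"


section \<open>Approximation dimension, metric dimension and product entropy\<close>

text \<open>The ambient normed space is the reduced C*-algebra; the infimum is \<open>\<infinity>\<close> if no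
  finite-dimensional subspace approximates \<open>Y\<close>.\<close>

definition approx_dim :: "('a, 'b) monoid_scheme \<Rightarrow> 'a operator set \<Rightarrow> real \<Rightarrow> enat" where
  "approx_dim G Y \<delta> = (INF Z\<in>{Z. op.subspace Z \<and> Z \<subseteq> Cstar_red G \<and>
        (\<exists>B. finite B \<and> Z = op.span B) \<and>
        (\<forall>y\<in>Y. \<exists>z\<in>Z. op_norm (ell2 G) (y - z) < ereal \<delta>)}. enat (op.dim Z))"

text \<open>Natural logarithm with \<open>log 0 = -\<infinity>\<close> and \<open>log \<infinity> = \<infinity>\<close>.\<close>

definition elog :: "enat \<Rightarrow> ereal" where
  "elog n = (case n of enat m \<Rightarrow> if m = 0 then -\<infinity> else ereal (ln (real m)) | \<infinity> \<Rightarrow> \<infinity>)"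

definition Mdim :: "('a, 'b) monoid_scheme \<Rightarrow> ('a operator \<Rightarrow> ereal) \<Rightarrow> ereal" where
  "Mdim G L = Limsup (at_right 0)
     (\<lambda>\<delta>. elog (approx_dim G {a \<in> Cstar_red G. L a < 1} \<delta>) / ereal (ln (1 / \<delta>)))"

definition induced :: "('a \<Rightarrow> 'a) \<Rightarrow> ('a \<Rightarrow> complex) \<Rightarrow> ('a \<Rightarrow> complex)" where
  "induced \<phi> f = (\<lambda>x. \<Sum>g\<in>supp f. f g * delta (\<phi> g) x)"

text \<open>The set of products \<open>a\<^sub>0 \<cdots> a\<^bsub>n-1\<^esub>\<close> with \<open>a\<^sub>i \<in> \<phi>\<^sup>i(\<Omega>)\<close>; multiplication in the reduced
  C*-algebra is composition, with unit \<open>lreg G (delta \<one>\<^bsub>G\<^esub>)\<close>.\<close>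

primrec orbit_products ::
  "('a, 'b) monoid_scheme \<Rightarrow> ('a \<Rightarrow> 'a) \<Rightarrow> ('a \<Rightarrow> complex) set \<Rightarrow> nat \<Rightarrow> 'a operator set" where
  "orbit_products G \<phi> \<Omega> 0 = {lreg G (delta \<one>\<^bsub>G\<^esub>)}"
| "orbit_products G \<phi> \<Omega> (Suc n) =
     {p \<circ> lreg G ((induced \<phi> ^^ n) f) |p f. p \<in> orbit_products G \<phi> \<Omega> n \<and> f \<in> \<Omega>}"

definition Entp_at ::
  "('a, 'b) monoid_scheme \<Rightarrow> ('a \<Rightarrow> 'a) \<Rightarrow> ('a \<Rightarrow> complex) set \<Rightarrow> real \<Rightarrow> ereal" where
  "Entp_at G \<phi> \<Omega> \<delta> =
     limsup (\<lambda>n. ereal (1 / real n) * elog (approx_dim G (orbit_products G \<phi> \<Omega> n) \<delta>))"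

definition Entp :: "('a, 'b) monoid_scheme \<Rightarrow> ('a \<Rightarrow> 'a) \<Rightarrow> ereal" where
  "Entp G \<phi> = (SUP \<Omega>\<in>{\<Omega>. finite \<Omega> \<and> \<Omega> \<subseteq> Cc_ball G}. SUP \<delta>\<in>{0<..}. Entp_at G \<phi> \<Omega> \<delta>)"

definition Ad :: "('a, 'b) monoid_scheme \<Rightarrow> 'a \<Rightarrow> 'a \<Rightarrow> 'a" where
  "Ad G z = (\<lambda>g\<in>carrier G. z \<otimes>\<^bsub>G\<^esub> g \<otimes>\<^bsub>G\<^esub> inv\<^bsub>G\<^esub> z)"

end

theory Submission
  imports Defs "HOL-Real_Asymp.Real_Asymp"
begin

text \<open>Commutation with \<open>M\<^sub>\<ell>\<close> is a derivation, so if \<open>\<parallel>\<Delta>\<^sup>j a\<parallel> \<le> K\<^sup>j\<close> and \<open>\<parallel>\<Delta>\<^sup>j b\<parallel> \<le> L\<^sup>j\<close> for all \<open>j\<close>, then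
  \<open>\<parallel>\<Delta>\<^sup>j (ab)\<parallel> \<le> (K + L)\<^sup>j\<close>.  Conjugation by \<open>z\<^sup>i\<close> adds only a multiple of \<open>i\<close> to such a constant, hence a
  product \<open>a\<^sub>0 \<cdots> a\<^bsub>n-1\<^esub>\<close> with \<open>a\<^sub>i \<in> Ad\<^sub>z\<^sup>i(\<Omega>)\<close> has a seminorm that grows only polynomially in \<open>n\<close>.
  After division by a polynomial \<open>t\<^sub>n\<close> these products lie in the unit ball of the seminorm, which is
  approximated within \<open>\<delta> / t\<^sub>n\<close> by a subspace of dimension at most \<open>(t\<^sub>n / \<delta>)\<^sup>c\<close>.  The logarithm of this
  dimension is \<open>O(log n)\<close>.\<close>

section \<open>The norm of \<open>\<ell>\<^sup>2\<close>\<close>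

lemma ell2_norm_nonneg: "0 \<le> ell2_norm \<xi>"
  unfolding ell2_norm_def by (simp add: infsum_nonneg)

lemma ell2_norm_scale: "ell2_norm (\<lambda>x. c * \<xi> x) = cmod c * ell2_norm \<xi>"
  by (simp add: ell2_norm_def norm_mult power_mult_distrib infsum_cmult_right' real_sqrt_mult)

text \<open>A bound on all finite partial sums gives summability and the norm bound together, so
  inequalities for finite \<open>L2_set\<close> pass to infinite sums.\<close>

lemma ell2_norm_boundI:
  assumes "\<And>F. finite F \<Longrightarrow> L2_set (\<lambda>x. cmod (\<xi> x)) F \<le> B"
  shows "(\<lambda>x. (cmod (\<xi> x))\<^sup>2) summable_on UNIV" and "ell2_norm \<xi> \<le> B"
proof -
  have B: "B \<ge> 0"
    using assms[of "{}"] by simp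
  have sums: "(\<Sum>x\<in>F. (cmod (\<xi> x))\<^sup>2) \<le> B\<^sup>2" if "finite F" for F
    using power_mono[OF assms[OF that] L2_set_nonneg, of 2]
    by (simp add: L2_set_def sum_nonneg)
  show *: "(\<lambda>x. (cmod (\<xi> x))\<^sup>2) summable_on UNIV"
    by (rule nonneg_bounded_partial_sums_imp_summable_on[of _ _ "B\<^sup>2"])
      (auto intro!: eventually_finite_subsets_at_top_weakI sums)
  have "(\<Sum>\<^sub>\<infinity>x. (cmod (\<xi> x))\<^sup>2) \<le> B\<^sup>2"
    using * by (rule infsum_le_finite_sums) (auto intro: sums)
  then show "ell2_norm \<xi> \<le> B"
    using B by (simp add: ell2_norm_def real_le_lsqrt)
qed

lemma L2_set_le_ell2_norm:
  assumes "(\<lambda>x. (cmod (\<xi> x))\<^sup>2) summable_on UNIV" and "finite F"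
  shows "L2_set (\<lambda>x. cmod (\<xi> x)) F \<le> ell2_norm \<xi>"
  unfolding L2_set_def ell2_norm_def
  by (rule real_sqrt_le_mono, rule finite_sum_le_infsum) (use assms in auto)

lemma L2_set_sum_le:
  assumes "finite A"
  shows "L2_set (\<lambda>x. \<Sum>a\<in>A. u a x) F \<le> (\<Sum>a\<in>A. L2_set (u a) F)"
  using assms
proof (induction A rule: finite_induct)
  case (insert a A)
  have "L2_set (\<lambda>x. u a x + (\<Sum>a\<in>A. u a x)) F \<le> L2_set (u a) F + L2_set (\<lambda>x. \<Sum>a\<in>A. u a x) F"
    by (rule L2_set_triangle_ineq)
  with insert show ?case by simp
qed (simp add: L2_set_def)

lemma
  assumes "\<xi> \<in> ell2 G" "\<eta> \<in> ell2 G"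
  shows ell2_add: "\<xi> + \<eta> \<in> ell2 G"
    and ell2_norm_triangle: "ell2_norm (\<xi> + \<eta>) \<le> ell2_norm \<xi> + ell2_norm \<eta>"
proof -
  have *: "L2_set (\<lambda>x. cmod ((\<xi> + \<eta>) x)) F \<le> ell2_norm \<xi> + ell2_norm \<eta>" if "finite F" for F
  proof -
    have "L2_set (\<lambda>x. cmod ((\<xi> + \<eta>) x)) F \<le> L2_set (\<lambda>x. cmod (\<xi> x) + cmod (\<eta> x)) F"
      by (rule L2_set_mono) (auto simp: norm_triangle_ineq)
    also have "\<dots> \<le> L2_set (\<lambda>x. cmod (\<xi> x)) F + L2_set (\<lambda>x. cmod (\<eta> x)) F"
      by (rule L2_set_triangle_ineq)
    also have "\<dots> \<le> ell2_norm \<xi> + ell2_norm \<eta>"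
      using assms that by (intro add_mono L2_set_le_ell2_norm) (auto simp: ell2_def)
    finally show ?thesis .
  qed
  have "\<xi> x = 0 \<and> \<eta> x = 0" if "x \<notin> carrier G" for x
    using assms that by (auto simp: ell2_def)
  then have "supp (\<xi> + \<eta>) \<subseteq> carrier G"
    by fastforce
  then show "\<xi> + \<eta> \<in> ell2 G"
    using ell2_norm_boundI(1)[OF *] by (simp add: ell2_def)
  show "ell2_norm (\<xi> + \<eta>) \<le> ell2_norm \<xi> + ell2_norm \<eta>"
    by (rule ell2_norm_boundI(2)[OF *])
qed

lemma ell2_scale: "\<xi> \<in> ell2 G \<Longrightarrow> (\<lambda>x. c * \<xi> x) \<in> ell2 G"
  by (auto simp: ell2_def norm_mult power_mult_distrib intro: summable_on_cmult_right)

lemma Cc_subset_ell2: "Cc G \<subseteq> ell2 G"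
  by (auto simp: Cc_def ell2_def intro!: finite_nonzero_values_imp_summable_on)

lemma Cc_diff:
  assumes "\<xi> \<in> Cc G" "\<eta> \<in> Cc G"
  shows "\<xi> - \<eta> \<in> Cc G"
proof -
  have "supp (\<xi> - \<eta>) \<subseteq> supp \<xi> \<union> supp \<eta>"
    by auto
  then show ?thesis
    using assms unfolding Cc_def mem_Collect_eq by (meson finite_UnI finite_subset le_supI order_trans)
qed

lemma Cc_scale: "\<xi> \<in> Cc G \<Longrightarrow> (\<lambda>x. c * \<xi> x) \<in> Cc G"
  by (auto simp: Cc_def intro: finite_subset[of _ "supp \<xi>"])

lemma Cc_mult_length: "\<xi> \<in> Cc G \<Longrightarrow> mult_length G S \<xi> \<in> Cc G"
  by (auto simp: Cc_def mult_length_def intro: finite_subset[of _ "supp \<xi>"])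

lemma supp_delta: "supp (delta g) = {g}"
  by (auto simp: delta_def)

lemma delta_in_Cc: "g \<in> carrier G \<Longrightarrow> delta g \<in> Cc G"
  by (simp add: Cc_def supp_delta)

lemma ell2_norm_delta: "ell2_norm (delta g) = 1"
proof -
  have "(\<Sum>\<^sub>\<infinity>x. (cmod (delta g x))\<^sup>2) = (\<Sum>\<^sub>\<infinity>x\<in>{g}. (cmod (delta g x))\<^sup>2)"
    by (rule infsum_cong_neutral) (auto simp: delta_def)
  then show ?thesis by (simp add: ell2_norm_def delta_def)
qed


section \<open>Operator norms\<close>

lemma op_norm_leI:
  assumes "\<And>\<xi>. \<xi> \<in> V \<Longrightarrow> ell2_norm (T \<xi>) \<le> B * ell2_norm \<xi>" and "B \<ge> 0"
  shows "op_norm V T \<le> ereal B"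
  unfolding op_norm_def
proof (rule SUP_least)
  fix \<xi> assume "\<xi> \<in> {\<xi> \<in> V. ell2_norm \<xi> \<le> 1}"
  then have "ell2_norm (T \<xi>) \<le> B * ell2_norm \<xi>" "B * ell2_norm \<xi> \<le> B * 1"
    using assms by (auto intro: mult_left_mono simp del: mult_1_right)
  then show "ereal (ell2_norm (T \<xi>)) \<le> ereal B" by simp
qed

lemma le_op_norm:
  assumes "\<xi> \<in> V" "ell2_norm \<xi> \<le> 1"
  shows "ereal (ell2_norm (T \<xi>)) \<le> op_norm V T"
  unfolding op_norm_def by (rule SUP_upper) (use assms in auto)

lemma op_norm_scale_le:
  assumes "c \<ge> 0"
  shows "op_norm V (op_scale (of_real c) T) \<le> ereal c * op_norm V T"
  unfolding op_norm_def[of _ "op_scale _ _"]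
proof (rule SUP_least)
  fix \<xi> assume "\<xi> \<in> {\<xi> \<in> V. ell2_norm \<xi> \<le> 1}"
  then have "ereal c * ereal (ell2_norm (T \<xi>)) \<le> ereal c * op_norm V T"
    using assms by (intro ereal_mult_left_mono le_op_norm) auto
  then show "ereal (ell2_norm (op_scale (of_real c) T \<xi>)) \<le> ereal c * op_norm V T"
    using assms by (simp add: op_scale_def ell2_norm_scale)
qed


section \<open>The left regular representation\<close>

text \<open>The support of a convolution can shrink by cancellation; this allows summing over any
  convenient finite superset instead.\<close>

lemma lreg_superset:
  assumes "finite A" "supp f \<subseteq> A" "\<xi> \<in> ell2 G" "h \<in> carrier G"
  shows "lreg G f \<xi> h = (\<Sum>g\<in>A. f g * \<xi> (inv\<^bsub>G\<^esub> g \<otimes>\<^bsub>G\<^esub> h))"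
  using assms by (auto simp: lreg_def intro!: sum.mono_neutral_left)

lemma lreg_outside: "\<xi> \<notin> ell2 G \<Longrightarrow> lreg G f \<xi> = 0"
  by (simp add: lreg_def fun_eq_iff)

lemma lreg_add:
  assumes "\<xi> \<in> ell2 G" "\<eta> \<in> ell2 G"
  shows "lreg G f (\<xi> + \<eta>) = lreg G f \<xi> + lreg G f \<eta>"
  using assms ell2_add[OF assms] by (auto simp: lreg_def fun_eq_iff algebra_simps sum.distrib)

lemma lreg_scale:
  assumes "\<xi> \<in> ell2 G"
  shows "lreg G f (\<lambda>x. c * \<xi> x) = (\<lambda>x. c * lreg G f \<xi> x)"
  using assms ell2_scale[OF assms, of c]
  by (auto simp: lreg_def fun_eq_iff sum_distrib_left intro!: sum.cong)

lemma lreg_diff: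
  assumes "\<xi> \<in> Cc G" "\<eta> \<in> Cc G"
  shows "lreg G f (\<xi> - \<eta>) = lreg G f \<xi> - lreg G f \<eta>"
  using assms Cc_subset_ell2[of G] Cc_diff[OF assms]
  by (auto simp: lreg_def fun_eq_iff algebra_simps sum_subtractf)

lemma op_scale_lreg:
  assumes "f \<in> Cc G"
  shows "op_scale c (lreg G f) = lreg G (\<lambda>x. c * f x)"
\<comment> \<open>For \<open>c = 0\<close> the support collapses to the empty set; otherwise
  \<open>f\<close> and its multiple have the same support.\<close>
proof (cases "c = 0")
  case False
  then show ?thesis
    by (auto simp: op_scale_def lreg_def fun_eq_iff sum_distrib_left algebra_simps)
qed (simp add: op_scale_def lreg_def fun_eq_iff)

context group
begin

text \<open>Left translations do not increase partial sums of squares, so the triangle inequality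
  over \<open>A\<close> suffices. Weights depending on \<open>h\<close> let one estimate serve both
  \<open>lreg\<close> and its iterated commutators.\<close>

lemma ell2_norm_weighted_translates:
  assumes A: "finite A" "A \<subseteq> carrier G" and \<xi>: "\<xi> \<in> ell2 G"
    and w: "\<And>a h. a \<in> A \<Longrightarrow> h \<in> carrier G \<Longrightarrow> cmod (w a h) \<le> W a"
  defines "\<eta> \<equiv> (\<lambda>h. if h \<in> carrier G then \<Sum>a\<in>A. w a h * \<xi> (inv a \<otimes> h) else 0)"
  shows "\<eta> \<in> ell2 G" and "ell2_norm \<eta> \<le> (\<Sum>a\<in>A. W a) * ell2_norm \<xi>"
proof -
  have *: "L2_set (\<lambda>h. cmod (\<eta> h)) F \<le> (\<Sum>a\<in>A. W a) * ell2_norm \<xi>" if "finite F" for F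
  proof -
    \<comment> \<open>\<open>\<eta>\<close> vanishes off the carrier, and translation is known to be
      injective only on it.\<close>
    define F' where "F' = F \<inter> carrier G"
    have "finite F'" using that by (simp add: F'_def)
    have "L2_set (\<lambda>h. cmod (\<eta> h)) F = L2_set (\<lambda>h. cmod (\<eta> h)) F'"
      unfolding L2_set_def using that
      by (intro arg_cong[where f = sqrt] sum.mono_neutral_right) (auto simp: F'_def \<eta>_def)
    also have "\<dots> \<le> L2_set (\<lambda>h. \<Sum>a\<in>A. W a * cmod (\<xi> (inv a \<otimes> h))) F'"
    proof (rule L2_set_mono)
      fix h assume "h \<in> F'"
      then have "cmod (\<eta> h) \<le> (\<Sum>a\<in>A. cmod (w a h * \<xi> (inv a \<otimes> h)))"
        by (simp add: \<eta>_def F'_def norm_sum)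
      also have "\<dots> \<le> (\<Sum>a\<in>A. W a * cmod (\<xi> (inv a \<otimes> h)))"
        using \<open>h \<in> F'\<close> by (intro sum_mono) (auto simp: norm_mult F'_def intro!: mult_right_mono w)
      finally show "cmod (\<eta> h) \<le> (\<Sum>a\<in>A. W a * cmod (\<xi> (inv a \<otimes> h)))" .
    qed simp
    also have "\<dots> \<le> (\<Sum>a\<in>A. L2_set (\<lambda>h. W a * cmod (\<xi> (inv a \<otimes> h))) F')"
      by (rule L2_set_sum_le) fact
    also have "\<dots> \<le> (\<Sum>a\<in>A. W a * ell2_norm \<xi>)"
    proof (rule sum_mono)
      fix a assume a: "a \<in> A"
      have W: "W a \<ge> 0"
        using order_trans[OF norm_ge_zero w[OF a one_closed]] .
      have inj: "inj_on (\<lambda>h. inv a \<otimes> h) F'"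
        using a A by (auto simp: inj_on_def F'_def)
      have "L2_set (\<lambda>h. cmod (\<xi> (inv a \<otimes> h))) F' = L2_set (\<lambda>h. cmod (\<xi> h)) ((\<lambda>h. inv a \<otimes> h) ` F')"
        by (simp add: L2_set_def sum.reindex[OF inj])
      also have "\<dots> \<le> ell2_norm \<xi>"
        using \<xi> \<open>finite F'\<close> by (intro L2_set_le_ell2_norm) (auto simp: ell2_def)
      finally show "L2_set (\<lambda>h. W a * cmod (\<xi> (inv a \<otimes> h))) F' \<le> W a * ell2_norm \<xi>"
        using W by (simp add: L2_set_right_distrib[symmetric] mult_left_mono)
    qed
    finally show ?thesis by (simp add: sum_distrib_right)
  qed
  show "\<eta> \<in> ell2 G"
    using ell2_norm_boundI(1)[OF *] by (auto simp: ell2_def \<eta>_def split: if_splits)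
  show "ell2_norm \<eta> \<le> (\<Sum>a\<in>A. W a) * ell2_norm \<xi>"
    by (rule ell2_norm_boundI(2)[OF *])
qed

lemma
  assumes f: "f \<in> Cc G" and \<xi>: "\<xi> \<in> ell2 G"
  shows lreg_ell2: "lreg G f \<xi> \<in> ell2 G"
    and ell2_norm_lreg_le: "ell2_norm (lreg G f \<xi>) \<le> (\<Sum>g\<in>supp f. cmod (f g)) * ell2_norm \<xi>"
proof -
  have eq: "lreg G f \<xi> = (\<lambda>h. if h \<in> carrier G then \<Sum>g\<in>supp f. f g * \<xi> (inv g \<otimes> h) else 0)"
    using \<xi> by (simp add: lreg_def)
  note * = ell2_norm_weighted_translates[of "supp f" \<xi> "\<lambda>g h. f g" "\<lambda>g. cmod (f g)"]
  show "lreg G f \<xi> \<in> ell2 G"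
    unfolding eq by (rule *(1)) (use f \<xi> in \<open>auto simp: Cc_def\<close>)
  show "ell2_norm (lreg G f \<xi>) \<le> (\<Sum>g\<in>supp f. cmod (f g)) * ell2_norm \<xi>"
    unfolding eq by (rule *(2)) (use f \<xi> in \<open>auto simp: Cc_def\<close>)
qed

lemma lreg_in_Cstar_red:
  assumes f: "f \<in> Cc G"
  shows "lreg G f \<in> Cstar_red G"
proof -
  have "op_norm (ell2 G) (lreg G f) \<le> ereal (\<Sum>g\<in>supp f. cmod (f g))"
    by (rule op_norm_leI) (auto intro: ell2_norm_lreg_le[OF f] sum_nonneg)
  then have "op_norm (ell2 G) (lreg G f) < \<infinity>"
    by (rule order_le_less_trans) simp
  then have "lreg G f \<in> bounded_ops G"
    using lreg_ell2[OF f] by (auto simp: bounded_ops_def lreg_outside lreg_add lreg_scale)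
  moreover have "op_norm (ell2 G) (lreg G f - lreg G f) \<le> ereal 0"
    by (rule op_norm_leI) (auto simp: ell2_norm_def)
  ultimately show ?thesis
    using f by (auto simp: Cstar_red_def intro!: bexI[of _ f] elim!: order_le_less_trans)
qed

lemma lreg_Cc:
  assumes f: "f \<in> Cc G" and \<xi>: "\<xi> \<in> Cc G"
  shows "supp (lreg G f \<xi>) \<subseteq> (\<lambda>(a, b). a \<otimes> b) ` (supp f \<times> supp \<xi>)" and "lreg G f \<xi> \<in> Cc G"
proof -
  show *: "supp (lreg G f \<xi>) \<subseteq> (\<lambda>(a, b). a \<otimes> b) ` (supp f \<times> supp \<xi>)"
  proof
    fix h assume "h \<in> supp (lreg G f \<xi>)"
    then have h: "h \<in> carrier G" and "(\<Sum>g\<in>supp f. f g * \<xi> (inv g \<otimes> h)) \<noteq> 0"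
      by (auto simp: lreg_def split: if_splits)
    then obtain g where g: "g \<in> supp f" "f g * \<xi> (inv g \<otimes> h) \<noteq> 0"
      by (meson sum.neutral)
    moreover have "g \<otimes> (inv g \<otimes> h) = h"
      using g f h by (auto simp: Cc_def m_assoc[symmetric])
    ultimately show "h \<in> (\<lambda>(a, b). a \<otimes> b) ` (supp f \<times> supp \<xi>)"
      by (auto intro!: image_eqI[of _ _ "(g, inv g \<otimes> h)"])
  qed
  have "finite ((\<lambda>(a, b). a \<otimes> b) ` (supp f \<times> supp \<xi>))"
    using f \<xi> by (auto simp: Cc_def)
  with * have "finite (supp (lreg G f \<xi>))"
    by (rule finite_subset)
  then show "lreg G f \<xi> \<in> Cc G"
    by (auto simp: Cc_def lreg_def split: if_splits)
qed

text \<open>The convolution of \<open>f\<close> and \<open>g\<close> is \<open>\<lambda>(f) g\<close>.\<close>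

lemma lreg_comp:
  assumes f: "f \<in> Cc G" and g: "g \<in> Cc G"
  shows "lreg G f \<circ> lreg G g = lreg G (lreg G f g)"
proof (intro ext)
  fix \<xi> h
  show "(lreg G f \<circ> lreg G g) \<xi> h = lreg G (lreg G f g) \<xi> h"
  proof (cases "\<xi> \<in> ell2 G \<and> h \<in> carrier G")
    case True
    \<comment> \<open>A finite set containing the support of the convolution, independent of
      \<open>a\<close>, so that the two sums can be interchanged.\<close>
    define P where "P = (\<lambda>(a, b). a \<otimes> b) ` (supp f \<times> supp g)"
    have fin: "finite (supp f)" "finite (supp g)" "finite P"
      using f g by (auto simp: P_def Cc_def)
    have carr: "supp f \<subseteq> carrier G" "supp g \<subseteq> carrier G" "P \<subseteq> carrier G"
      using f g by (auto simp: P_def Cc_def)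
    \<comment> \<open>For fixed \<open>a\<close> only the \<open>c = a \<otimes> b\<close> with
      \<open>b\<close> in the support of \<open>g\<close> contribute; then substitute.\<close>
    have inner: "(\<Sum>c\<in>P. g (inv a \<otimes> c) * \<xi> (inv c \<otimes> h)) = lreg G g \<xi> (inv a \<otimes> h)"
      if a: "a \<in> supp f" for a
    proof -
      have aG: "a \<in> carrier G" using a carr by blast
      have "(\<Sum>c\<in>P. g (inv a \<otimes> c) * \<xi> (inv c \<otimes> h))
          = (\<Sum>c\<in>(\<lambda>b. a \<otimes> b) ` supp g. g (inv a \<otimes> c) * \<xi> (inv c \<otimes> h))"
      proof (rule sum.mono_neutral_right)
        show "\<forall>c\<in>P - (\<lambda>b. a \<otimes> b) ` supp g. g (inv a \<otimes> c) * \<xi> (inv c \<otimes> h) = 0"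
        proof
          fix c assume c: "c \<in> P - (\<lambda>b. a \<otimes> b) ` supp g"
          then have "c = a \<otimes> (inv a \<otimes> c)"
            using aG carr by (auto simp: m_assoc[symmetric])
          with c have "inv a \<otimes> c \<notin> supp g" by blast
          then show "g (inv a \<otimes> c) * \<xi> (inv c \<otimes> h) = 0" by simp
        qed
      qed (use a fin in \<open>auto simp: P_def\<close>)
      also have "\<dots> = (\<Sum>b\<in>supp g. g (inv a \<otimes> (a \<otimes> b)) * \<xi> (inv (a \<otimes> b) \<otimes> h))"
        using aG carr by (subst sum.reindex) (auto simp: inj_on_def subset_iff)
      also have "\<dots> = (\<Sum>b\<in>supp g. g b * \<xi> (inv b \<otimes> (inv a \<otimes> h)))"
      proof (rule sum.cong)
        fix b assume "b \<in> supp g"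
        then have "b \<in> carrier G" using carr by blast
        then show "g (inv a \<otimes> (a \<otimes> b)) * \<xi> (inv (a \<otimes> b) \<otimes> h) = g b * \<xi> (inv b \<otimes> (inv a \<otimes> h))"
          using aG True by (simp add: inv_mult_group m_assoc) (simp add: m_assoc[symmetric])
      qed simp
      also have "\<dots> = lreg G g \<xi> (inv a \<otimes> h)"
        using True aG by (simp add: lreg_def)
      finally show ?thesis .
    qed
    have "lreg G (lreg G f g) \<xi> h = (\<Sum>c\<in>P. lreg G f g c * \<xi> (inv c \<otimes> h))"
      using True fin lreg_Cc(1)[OF f g] by (intro lreg_superset) (auto simp: P_def)
    also have "\<dots> = (\<Sum>c\<in>P. \<Sum>a\<in>supp f. f a * (g (inv a \<otimes> c) * \<xi> (inv c \<otimes> h)))"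
    proof (rule sum.cong)
      fix c assume "c \<in> P"
      then show "lreg G f g c * \<xi> (inv c \<otimes> h)
          = (\<Sum>a\<in>supp f. f a * (g (inv a \<otimes> c) * \<xi> (inv c \<otimes> h)))"
        using carr g Cc_subset_ell2[of G] by (auto simp: lreg_def sum_distrib_right mult.assoc)
    qed simp
    also have "\<dots> = (\<Sum>a\<in>supp f. f a * (\<Sum>c\<in>P. g (inv a \<otimes> c) * \<xi> (inv c \<otimes> h)))"
      by (subst sum.swap) (simp add: sum_distrib_left)
    also have "\<dots> = (\<Sum>a\<in>supp f. f a * lreg G g \<xi> (inv a \<otimes> h))"
      by (intro sum.cong) (auto simp: inner)
    also have "\<dots> = (lreg G f \<circ> lreg G g) \<xi> h"
      using True lreg_ell2[OF g] by (simp add: lreg_def[of G f])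
    finally show ?thesis by simp
  next
    case False
    then show ?thesis
      by (cases "\<xi> \<in> ell2 G") (auto simp: lreg_def)
  qed
qed

section \<open>Point masses, contractions and inner automorphisms\<close>

lemma lreg_delta_apply:
  assumes "z \<in> carrier G" "\<xi> \<in> ell2 G" "h \<in> carrier G"
  shows "lreg G (delta z) \<xi> h = \<xi> (inv z \<otimes> h)"
  using assms by (simp add: lreg_def supp_delta) (simp add: delta_def)

lemma lreg_delta_one:
  assumes "\<xi> \<in> ell2 G"
  shows "lreg G (delta \<one>) \<xi> = \<xi>"
proof
  fix h
  show "lreg G (delta \<one>) \<xi> h = \<xi> h"
  proof (cases "h \<in> carrier G")
    case True
    then show ?thesis using assms by (simp add: lreg_delta_apply)
  next
    case False
    then show ?thesis using assms by (auto simp: lreg_def ell2_def)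
  qed
qed

lemma delta_in_Cc_ball:
  assumes "z \<in> carrier G"
  shows "delta z \<in> Cc_ball G"
proof -
  have "op_norm (ell2 G) (lreg G (delta z)) \<le> ereal 1"
  proof (rule op_norm_leI)
    fix \<xi> assume "\<xi> \<in> ell2 G"
    from ell2_norm_lreg_le[OF delta_in_Cc[OF assms] this]
    show "ell2_norm (lreg G (delta z) \<xi>) \<le> 1 * ell2_norm \<xi>"
      by (simp add: supp_delta) (simp add: delta_def)
  qed simp
  then show ?thesis
    using delta_in_Cc[OF assms] by (simp add: Cc_ball_def red_norm_def one_ereal_def)
qed

lemma ell2_norm_lreg_le_of_Cc_ball:
  assumes f: "f \<in> Cc_ball G" and \<xi>: "\<xi> \<in> ell2 G"
  shows "ell2_norm (lreg G f \<xi>) \<le> ell2_norm \<xi>"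
proof (cases "ell2_norm \<xi> = 0")
  \<comment> \<open>Normalisation is impossible here; the bound by the sum of the coefficients
    already makes the image have norm 0.\<close>
  case True
  then show ?thesis
    using ell2_norm_lreg_le[of f \<xi>] f \<xi> by (simp add: Cc_ball_def)
next
  case False
  define n where "n = ell2_norm \<xi>"
  have n: "n > 0" using False ell2_norm_nonneg[of \<xi>] by (simp add: n_def)
  let ?\<eta> = "\<lambda>x. complex_of_real (1 / n) * \<xi> x"
  have "ell2_norm ?\<eta> = 1"
    using n by (subst ell2_norm_scale) (simp add: n_def norm_divide)
  then have "ereal (ell2_norm (lreg G f ?\<eta>)) \<le> op_norm (ell2 G) (lreg G f)"
    by (intro le_op_norm ell2_scale \<xi>) simp
  also have "\<dots> \<le> ereal 1"
    using f by (simp add: Cc_ball_def red_norm_def one_ereal_def)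
  finally have "ell2_norm (lreg G f ?\<eta>) \<le> 1" by simp
  then have "1 / n * ell2_norm (lreg G f \<xi>) \<le> 1"
    using n unfolding lreg_scale[OF \<xi>] ell2_norm_scale by (simp add: norm_divide)
  then show ?thesis
    using n by (simp add: n_def[symmetric] field_simps)
qed

text \<open>Since \<open>lreg\<close> applied to a finitely supported function is convolution, the
  inner automorphism is convolution by \<open>delta z\<close> on the left and
  \<open>delta (inv z)\<close> on the right.\<close>

lemma induced_Ad:
  assumes z: "z \<in> carrier G" and f: "f \<in> Cc G"
  shows "induced (Ad G z) f = lreg G (delta z) (lreg G f (delta (inv z)))"
proof
  fix x
  have carr: "supp f \<subseteq> carrier G" using f by (simp add: Cc_def)
  have d: "delta (inv z) \<in> Cc G" using z by (intro delta_in_Cc) simp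
  show "induced (Ad G z) f x = lreg G (delta z) (lreg G f (delta (inv z))) x"
  proof (cases "x \<in> carrier G")
    case True
    have "delta (Ad G z g) x = delta (inv z) (inv g \<otimes> (inv z \<otimes> x))" if "g \<in> supp f" for g
    proof -
      have g: "g \<in> carrier G" using that carr by blast
      have "x = z \<otimes> g \<otimes> inv z \<longleftrightarrow> inv g \<otimes> (inv z \<otimes> x) = inv z"
        using True z g by (metis inv_closed inv_solve_left m_assoc m_closed)
      then show ?thesis using g by (simp add: delta_def Ad_def)
    qed
    then have "induced (Ad G z) f x = (\<Sum>g\<in>supp f. f g * delta (inv z) (inv g \<otimes> (inv z \<otimes> x)))"
      by (simp add: induced_def)
    also have "\<dots> = lreg G f (delta (inv z)) (inv z \<otimes> x)"
      using True z d Cc_subset_ell2[of G] by (auto simp: lreg_def)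
    also have "\<dots> = lreg G (delta z) (lreg G f (delta (inv z))) x"
      using True z lreg_Cc(2)[OF f d] Cc_subset_ell2[of G] by (subst lreg_delta_apply) auto
    finally show ?thesis .
  next
    case False
    then have "delta (Ad G z g) x = 0" if "g \<in> supp f" for g
      using that carr z by (auto simp: delta_def Ad_def)
    then have "induced (Ad G z) f x = 0"
      by (simp add: induced_def)
    then show ?thesis using False by (simp add: lreg_def)
  qed
qed

text \<open>The conjugate becomes a composition of three operators, each of whose commutators can be
  bounded separately.\<close>

lemma
  assumes z: "z \<in> carrier G" and f: "f \<in> Cc G"
  shows induced_Ad_Cc: "induced (Ad G z) f \<in> Cc G"
    and lreg_induced_Ad:
      "lreg G (induced (Ad G z) f) = lreg G (delta z) \<circ> (lreg G f \<circ> lreg G (delta (inv z)))"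
proof -
  have d: "delta z \<in> Cc G" "delta (inv z) \<in> Cc G"
    using z by (auto intro: delta_in_Cc)
  note c = lreg_Cc(2)[OF f d(2)]
  show "induced (Ad G z) f \<in> Cc G"
    unfolding induced_Ad[OF z f] by (rule lreg_Cc(2)[OF d(1) c])
  show "lreg G (induced (Ad G z) f) = lreg G (delta z) \<circ> (lreg G f \<circ> lreg G (delta (inv z)))"
    by (simp only: induced_Ad[OF z f] lreg_comp[OF f d(2)] lreg_comp[OF d(1) c])
qed

end

section \<open>Word length\<close>

locale generated_group = group G for G (structure) +
  fixes S :: "'a set"
  assumes S_subset: "S \<subseteq> carrier G" and generate_S: "generate G S = carrier G"
begin

abbreviation (input) len :: "'a \<Rightarrow> nat" where
  "len \<equiv> word_length G S"

lemma foldr_mult_closed: "set ws \<subseteq> carrier G \<Longrightarrow> foldr (\<otimes>) ws \<one> \<in> carrier G"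
  by (induction ws) auto

lemma foldr_mult_append:
  "set us \<subseteq> carrier G \<Longrightarrow> set vs \<subseteq> carrier G \<Longrightarrow>
    foldr (\<otimes>) us (foldr (\<otimes>) vs \<one>) = foldr (\<otimes>) us \<one> \<otimes> foldr (\<otimes>) vs \<one>"
  by (induction us) (auto simp: foldr_mult_closed m_assoc)

lemma letters_subset: "S \<union> m_inv G ` S \<subseteq> carrier G"
  using S_subset by auto

lemma word_exists:
  "g \<in> generate G S \<Longrightarrow> \<exists>ws. set ws \<subseteq> S \<union> m_inv G ` S \<and> g = foldr (\<otimes>) ws \<one>"
proof (induction rule: generate.induct)
  case one
  show ?case by (intro exI[of _ "[]"]) simp
next
  case (incl h)
  then show ?case using S_subset by (intro exI[of _ "[h]"]) auto
next
  case (inv h)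
  then show ?case using S_subset by (intro exI[of _ "[inv h]"]) auto
next
  case (eng g h)
  then obtain us vs where
    "set us \<subseteq> S \<union> m_inv G ` S" "g = foldr (\<otimes>) us \<one>"
    "set vs \<subseteq> S \<union> m_inv G ` S" "h = foldr (\<otimes>) vs \<one>"
    by blast
  then show ?case
    using letters_subset foldr_mult_append[of us vs]
    by (intro exI[of _ "us @ vs"]) (simp add: subset_trans)
qed

text \<open>The \<open>LEAST\<close> in the definition is attained because \<open>S\<close>
  generates the group.\<close>

lemma word_length_witness:
  assumes "g \<in> carrier G"
  obtains ws where "length ws = len g" "set ws \<subseteq> S \<union> m_inv G ` S" "g = foldr (\<otimes>) ws \<one>"
proof -
  have "\<exists>n ws. length ws = n \<and> set ws \<subseteq> S \<union> m_inv G ` S \<and> g = foldr (\<otimes>) ws \<one>"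
    using word_exists[of g] assms generate_S by auto
  from LeastI_ex[OF this] show thesis
    using that unfolding word_length_def by blast
qed

lemma word_length_mult_le:
  assumes "g \<in> carrier G" "h \<in> carrier G"
  shows "len (g \<otimes> h) \<le> len g + len h"
proof -
  obtain us where us: "length us = len g" "set us \<subseteq> S \<union> m_inv G ` S" "g = foldr (\<otimes>) us \<one>"
    using assms word_length_witness by blast
  obtain vs where vs: "length vs = len h" "set vs \<subseteq> S \<union> m_inv G ` S" "h = foldr (\<otimes>) vs \<one>"
    using assms word_length_witness by blast
  have "g \<otimes> h = foldr (\<otimes>) (us @ vs) \<one>"
    using foldr_mult_append[OF subset_trans[OF us(2) letters_subset] subset_trans[OF vs(2) letters_subset]]
      us(3) vs(3) by simp
  then show ?thesis
    unfolding word_length_def[of G S "g \<otimes> h"]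
    by (intro Least_le exI[of _ "us @ vs"]) (use us vs in auto)
qed

text \<open>Subadditivity for \<open>h = a \<otimes> (inv a \<otimes> h)\<close> costs
  \<open>len a\<close>, and for \<open>inv a \<otimes> h\<close> it costs
  \<open>len (inv a)\<close>. The bound is uniform in \<open>h\<close>, which is what makes the
  commutators bounded.\<close>

lemma word_length_diff_le:
  assumes "a \<in> carrier G" "h \<in> carrier G"
  shows "\<bar>real (len h) - real (len (inv a \<otimes> h))\<bar> \<le> real (len a) + real (len (inv a))"
proof -
  have "len h \<le> len a + len (inv a \<otimes> h)"
    using word_length_mult_le[of a "inv a \<otimes> h"] assms by (simp add: m_assoc[symmetric])
  moreover have "len (inv a \<otimes> h) \<le> len (inv a) + len h"
    using word_length_mult_le[of "inv a" h] assms by simp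
  ultimately show ?thesis by linarith
qed


section \<open>Iterated commutators with the length operator\<close>

abbreviation (input) D :: "'a operator \<Rightarrow> 'a operator" where
  "D \<equiv> commutator (mult_length G S)"

lemma D_pow_add: "(D ^^ k) (A + B) = (D ^^ k) A + (D ^^ k) B"
  by (induction k) (auto simp: commutator_def mult_length_def fun_eq_iff algebra_simps)

lemma D_pow_scale: "(D ^^ k) (op_scale c A) = op_scale c ((D ^^ k) A)"
  by (induction k) (auto simp: commutator_def mult_length_def op_scale_def fun_eq_iff algebra_simps)

text \<open>The length operator preserves \<open>Cc G\<close>, so iterated commutators there see
  only values there. This permits rewriting under \<open>D ^^ k\<close> with identities valid only
  on \<open>Cc G\<close>, such as the Leibniz rule.\<close>

lemma D_pow_cong:
  assumes "\<And>\<xi>. \<xi> \<in> Cc G \<Longrightarrow> A \<xi> = B \<xi>" "\<xi> \<in> Cc G"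
  shows "(D ^^ k) A \<xi> = (D ^^ k) B \<xi>"
  using assms(2) by (induction k arbitrary: \<xi>) (auto simp: commutator_def assms(1) Cc_mult_length)

text \<open>Operators are arbitrary functions as far as their type goes; invariance of
  \<open>Cc G\<close> and compatibility with differences are what the Leibniz rule requires.\<close>

definition Cc_endo :: "'a operator \<Rightarrow> bool" where
  "Cc_endo A \<longleftrightarrow> (\<forall>\<xi>\<in>Cc G. A \<xi> \<in> Cc G) \<and> (\<forall>\<xi>\<in>Cc G. \<forall>\<eta>\<in>Cc G. A (\<xi> - \<eta>) = A \<xi> - A \<eta>)"

lemma Cc_endo_D:
  assumes "Cc_endo A"
  shows "Cc_endo (D A)"
proof -
  have "mult_length G S (\<xi> - \<eta>) = mult_length G S \<xi> - mult_length G S \<eta>" for \<xi> \<eta>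
    by (auto simp: mult_length_def algebra_simps)
  then show ?thesis
    using assms by (auto simp: Cc_endo_def commutator_def Cc_mult_length intro: Cc_diff)
qed

lemma Cc_endo_D_pow: "Cc_endo A \<Longrightarrow> Cc_endo ((D ^^ k) A)"
  by (induction k) (auto intro: Cc_endo_D)

text \<open>The Leibniz rule: \<open>A\<close> is split over the difference
  \<open>D B \<xi>\<close>, and the two middle terms cancel.\<close>

lemma D_comp:
  assumes "Cc_endo A" "Cc_endo B" "\<xi> \<in> Cc G"
  shows "D (A \<circ> B) \<xi> = ((D A \<circ> B) + (A \<circ> D B)) \<xi>"
proof -
  have "A (mult_length G S (B \<xi>) - B (mult_length G S \<xi>))
      = A (mult_length G S (B \<xi>)) - A (B (mult_length G S \<xi>))"
    using assms Cc_mult_length[of _ G S] by (simp add: Cc_endo_def)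
  then show ?thesis by (simp add: commutator_def)
qed

text \<open>Letting the bound depend on two further orders \<open>i\<close>, \<open>j\<close> makes the Leibniz rule an induction
  without binomial coefficients.\<close>

lemma D_pow_comp_bound:
  assumes A: "Cc_endo A" "\<And>i \<xi>. \<xi> \<in> Cc G \<Longrightarrow> ell2_norm ((D ^^ i) A \<xi>) \<le> a ^ i * ell2_norm \<xi>"
    and B: "Cc_endo B" "\<And>i \<xi>. \<xi> \<in> Cc G \<Longrightarrow> ell2_norm ((D ^^ i) B \<xi>) \<le> b ^ i * ell2_norm \<xi>"
    and "a \<ge> 0" "\<xi> \<in> Cc G"
  shows "ell2_norm ((D ^^ k) ((D ^^ i) A \<circ> (D ^^ j) B) \<xi>) \<le> a ^ i * b ^ j * (a + b) ^ k * ell2_norm \<xi>"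
proof (induction k arbitrary: i j)
  case 0
  have "(D ^^ j) B \<xi> \<in> Cc G"
    using Cc_endo_D_pow[OF B(1)] \<open>\<xi> \<in> Cc G\<close> by (simp add: Cc_endo_def)
  from A(2)[OF this, of i] have "ell2_norm ((D ^^ i) A ((D ^^ j) B \<xi>)) \<le> a ^ i * ell2_norm ((D ^^ j) B \<xi>)" .
  also have "\<dots> \<le> a ^ i * (b ^ j * ell2_norm \<xi>)"
    using B(2)[OF \<open>\<xi> \<in> Cc G\<close>] \<open>a \<ge> 0\<close> by (intro mult_left_mono) auto
  finally show ?case by (simp add: mult.assoc)
next
  case (Suc k)
  let ?A = "\<lambda>i. (D ^^ i) A" and ?B = "\<lambda>j. (D ^^ j) B"
  have endo: "Cc_endo ((D ^^ k) (?A i \<circ> ?B j))" for i j k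
    using Cc_endo_D_pow[OF A(1), of i] Cc_endo_D_pow[OF B(1), of j]
    by (intro Cc_endo_D_pow) (simp add: Cc_endo_def)
  have mem: "(D ^^ k) (?A i \<circ> ?B j) \<xi> \<in> ell2 G" for i j k
    using endo[of k i j] \<open>\<xi> \<in> Cc G\<close> Cc_subset_ell2[of G] by (auto simp: Cc_endo_def)
  \<comment> \<open>Removing the innermost commutator leaves two compositions of the same shape,
    with \<open>i\<close> or \<open>j\<close> raised by one, to which the induction hypothesis
    applies.\<close>
  have "(D ^^ Suc k) (?A i \<circ> ?B j) \<xi> = (D ^^ k) (D (?A i \<circ> ?B j)) \<xi>"
    by (simp add: funpow_swap1)
  also have "\<dots> = (D ^^ k) ((D (?A i) \<circ> ?B j) + (?A i \<circ> D (?B j))) \<xi>"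
    using D_comp[OF Cc_endo_D_pow[OF A(1)] Cc_endo_D_pow[OF B(1)]] \<open>\<xi> \<in> Cc G\<close>
    by (rule D_pow_cong)
  also have "\<dots> = (D ^^ k) (?A (Suc i) \<circ> ?B j) \<xi> + (D ^^ k) (?A i \<circ> ?B (Suc j)) \<xi>"
    by (simp add: D_pow_add)
  finally have "ell2_norm ((D ^^ Suc k) (?A i \<circ> ?B j) \<xi>)
      \<le> ell2_norm ((D ^^ k) (?A (Suc i) \<circ> ?B j) \<xi>) + ell2_norm ((D ^^ k) (?A i \<circ> ?B (Suc j)) \<xi>)"
    by (simp only: ell2_norm_triangle[OF mem mem])
  also have "\<dots> \<le> a ^ Suc i * b ^ j * (a + b) ^ k * ell2_norm \<xi>
      + a ^ i * b ^ Suc j * (a + b) ^ k * ell2_norm \<xi>"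
    by (intro add_mono Suc.IH)
  also have "\<dots> = a ^ i * b ^ j * (a + b) ^ Suc k * ell2_norm \<xi>"
    by (simp add: algebra_simps)
  finally show ?case .
qed

text \<open>In matrix terms, each commutator multiplies the entry from
  \<open>inv a \<otimes> h\<close> to \<open>h\<close> by the difference of the lengths of
  \<open>h\<close> and \<open>inv a \<otimes> h\<close>.\<close>

lemma D_pow_lreg:
  assumes f: "f \<in> Cc G" and \<xi>: "\<xi> \<in> Cc G"
  shows "(D ^^ j) (lreg G f) \<xi> = (\<lambda>h. if h \<in> carrier G then
    \<Sum>a\<in>supp f. (f a * (of_nat (len h) - of_nat (len (inv a \<otimes> h))) ^ j) * \<xi> (inv a \<otimes> h) else 0)"
  using \<xi>
proof (induction j arbitrary: \<xi>)
  case 0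
  then have "\<xi> \<in> ell2 G"
    using Cc_subset_ell2 by blast
  then show ?case by (simp add: lreg_def cong: if_cong)
next
  case (Suc j)
  have "(D ^^ Suc j) (lreg G f) \<xi>
      = mult_length G S ((D ^^ j) (lreg G f) \<xi>) - (D ^^ j) (lreg G f) (mult_length G S \<xi>)"
    by (simp add: commutator_def)
  also have "\<dots> = (\<lambda>h. if h \<in> carrier G then
    \<Sum>a\<in>supp f. (f a * (of_nat (len h) - of_nat (len (inv a \<otimes> h))) ^ Suc j) * \<xi> (inv a \<otimes> h) else 0)"
    unfolding Suc.IH[OF Suc.prems] Suc.IH[OF Cc_mult_length[OF Suc.prems]]
    by (auto simp: fun_eq_iff mult_length_def sum_distrib_left algebra_simps sum_subtractf)
  finally show ?case .
qed

text \<open>A geometric bound at all orders at once makes the constants add under composition. Order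
  0 says that \<open>T\<close> is a contraction on \<open>Cc G\<close>, so no factor accumulates in
  long products.\<close>

definition controlled :: "real \<Rightarrow> 'a operator \<Rightarrow> bool" where
  "controlled K T \<longleftrightarrow> K \<ge> 0 \<and> T \<in> lreg G ` Cc G \<and>
    (\<forall>j. \<forall>\<xi>\<in>Cc G. ell2_norm ((D ^^ j) T \<xi>) \<le> K ^ j * ell2_norm \<xi>)"

lemma controlled_mono:
  assumes "controlled K T" "K \<le> K'"
  shows "controlled K' T"
  unfolding controlled_def
proof (intro conjI allI ballI)
  show "K' \<ge> 0" "T \<in> lreg G ` Cc G"
    using assms by (auto simp: controlled_def)
  fix j \<xi> assume "\<xi> \<in> Cc G"
  then have "ell2_norm ((D ^^ j) T \<xi>) \<le> K ^ j * ell2_norm \<xi>"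
    using assms by (simp add: controlled_def)
  also have "\<dots> \<le> K' ^ j * ell2_norm \<xi>"
    using assms by (intro mult_right_mono power_mono ell2_norm_nonneg) (auto simp: controlled_def)
  finally show "ell2_norm ((D ^^ j) T \<xi>) \<le> K' ^ j * ell2_norm \<xi>" .
qed

lemma Cc_endo_lreg: "f \<in> Cc G \<Longrightarrow> Cc_endo (lreg G f)"
  using lreg_Cc(2) lreg_diff by (auto simp: Cc_endo_def)

lemma controlled_comp:
  assumes A: "controlled a A" and B: "controlled b B"
  shows "controlled (a + b) (A \<circ> B)"
  unfolding controlled_def
proof (intro conjI allI ballI)
  show "a + b \<ge> 0" using A B by (simp add: controlled_def)
  obtain f g where f: "f \<in> Cc G" "A = lreg G f" and g: "g \<in> Cc G" "B = lreg G g"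
    using A B by (auto simp: controlled_def)
  show "A \<circ> B \<in> lreg G ` Cc G"
    using lreg_comp[OF f(1) g(1)] lreg_Cc(2)[OF f(1) g(1)] f(2) g(2) by simp
  fix j \<xi> assume "\<xi> \<in> Cc G"
  then show "ell2_norm ((D ^^ j) (A \<circ> B) \<xi>) \<le> (a + b) ^ j * ell2_norm \<xi>"
    using D_pow_comp_bound[of A a B b \<xi> j 0 0] A B Cc_endo_lreg f g by (simp add: controlled_def)
qed

text \<open>Length differences are at most \<open>m\<close>, so order \<open>j\<close> is bounded by
  \<open>c * m ^ j\<close>. For \<open>j \<ge> 1\<close> the prefactor is absorbed through
  \<open>c \<le> (1 + c) ^ j\<close>.\<close>

lemma controlled_lreg:
  assumes "f \<in> Cc_ball G"
  shows "\<exists>K. controlled K (lreg G f)"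
proof -
  define m where "m = (\<Sum>a\<in>supp f. real (len a) + real (len (inv a)))"
  define c where "c = (\<Sum>a\<in>supp f. cmod (f a))"
  have f: "f \<in> Cc G" "finite (supp f)" "supp f \<subseteq> carrier G"
    using assms by (auto simp: Cc_ball_def Cc_def)
  have pos: "c \<ge> 0" "m \<ge> 0"
    by (auto simp: c_def m_def intro!: sum_nonneg)
  have "controlled ((1 + c) * m) (lreg G f)"
    unfolding controlled_def
  proof (intro conjI allI ballI)
    show "(1 + c) * m \<ge> 0" "lreg G f \<in> lreg G ` Cc G"
      using pos f by auto
    fix j \<xi> assume \<xi>: "\<xi> \<in> Cc G"
    then have \<xi>': "\<xi> \<in> ell2 G" using Cc_subset_ell2[of G] by blast
    show "ell2_norm ((D ^^ j) (lreg G f) \<xi>) \<le> ((1 + c) * m) ^ j * ell2_norm \<xi>"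
    \<comment> \<open>At order 0 the bound must be exactly 1; it comes from the reduced norm being
      at most 1.\<close>
    proof (cases "j = 0")
      case True
      then show ?thesis
        using ell2_norm_lreg_le_of_Cc_ball[OF assms \<xi>'] by simp
    next
      case False
      have "ell2_norm ((D ^^ j) (lreg G f) \<xi>) \<le> (\<Sum>a\<in>supp f. cmod (f a) * m ^ j) * ell2_norm \<xi>"
        unfolding D_pow_lreg[OF f(1) \<xi>]
      proof (rule ell2_norm_weighted_translates(2)[OF f(2,3) \<xi>'])
        fix a h assume a: "a \<in> supp f" and h: "h \<in> carrier G"
        have "cmod (of_nat (len h) - of_nat (len (inv a \<otimes> h)))
            = \<bar>real (len h) - real (len (inv a \<otimes> h))\<bar>"
          by (metis norm_of_real of_real_diff of_real_of_nat_eq)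
        also have "\<dots> \<le> real (len a) + real (len (inv a))"
          using word_length_diff_le[of a h] a f h by auto
        also have "\<dots> \<le> m"
          unfolding m_def by (rule member_le_sum[OF a]) (use f in auto)
        finally show "cmod (f a * (of_nat (len h) - of_nat (len (inv a \<otimes> h))) ^ j) \<le> cmod (f a) * m ^ j"
          by (auto simp: norm_mult norm_power intro!: mult_left_mono power_mono)
      qed
      also have "(\<Sum>a\<in>supp f. cmod (f a) * m ^ j) = c * m ^ j"
        by (simp add: c_def sum_distrib_right)
      also have "c * m ^ j * ell2_norm \<xi> \<le> ((1 + c) * m) ^ j * ell2_norm \<xi>"
      proof -
        have "c \<le> (1 + c) ^ 1" by simp
        also have "\<dots> \<le> (1 + c) ^ j" using False pos by (intro power_increasing) auto
        finally show ?thesis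
          using pos by (auto simp: power_mult_distrib intro!: mult_right_mono ell2_norm_nonneg)
      qed
      finally show ?thesis .
    qed
  qed
  then show ?thesis ..
qed


section \<open>Polynomial growth of the seminorms along orbit products\<close>

text \<open>Each further conjugation composes with two point masses, and each of them adds
  \<open>L\<close> to the constant.\<close>

lemma controlled_induced_pow:
  assumes z: "z \<in> carrier G" and L: "controlled L (lreg G (delta z))" "controlled L (lreg G (delta (inv z)))"
    and f: "f \<in> Cc G" and K: "controlled K (lreg G f)"
  shows "(induced (Ad G z) ^^ n) f \<in> Cc G \<and>
    controlled (K + 2 * real n * L) (lreg G ((induced (Ad G z) ^^ n) f))"
proof (induction n)
  case (Suc n)
  define g where "g = (induced (Ad G z) ^^ n) f"
  have g: "g \<in> Cc G" "controlled (K + 2 * real n * L) (lreg G g)"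
    using Suc.IH by (auto simp: g_def)
  have "controlled (L + (K + 2 * real n * L + L)) (lreg G (induced (Ad G z) g))"
    unfolding lreg_induced_Ad[OF z g(1)] by (intro controlled_comp L g(2))
  then show ?case
    using induced_Ad_Cc[OF z g(1)] by (simp add: g_def[symmetric] algebra_simps)
qed (use f K in simp)

text \<open>The constants of the factors add up. Those of all \<open>n\<close> factors are estimated
  by the common value \<open>K + 2 * real n * L\<close>; the initial \<open>L\<close> belongs to the
  unit.\<close>

lemma controlled_orbit_products:
  assumes z: "z \<in> carrier G" and L: "controlled L (lreg G (delta z))" "controlled L (lreg G (delta (inv z)))"
      "controlled L (lreg G (delta \<one>))"
    and \<Omega>: "\<Omega> \<subseteq> Cc G" "\<And>f. f \<in> \<Omega> \<Longrightarrow> controlled K (lreg G f)" and K: "K \<ge> 0"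
  shows "p \<in> orbit_products G (Ad G z) \<Omega> n \<Longrightarrow> controlled (L + real n * (K + 2 * real n * L)) p"
proof (induction n arbitrary: p)
  case 0
  then show ?case using L(3) by simp
next
  case (Suc n)
  then obtain q f where q: "q \<in> orbit_products G (Ad G z) \<Omega> n" and f: "f \<in> \<Omega>"
    and p: "p = q \<circ> lreg G ((induced (Ad G z) ^^ n) f)"
    by auto
  have "controlled (L + real n * (K + 2 * real n * L) + (K + 2 * real n * L)) p"
    unfolding p using Suc.IH[OF q] controlled_induced_pow[OF z L(1,2), of f K n] f \<Omega>
    by (intro controlled_comp) auto
  moreover have "L \<ge> 0" using L by (simp add: controlled_def)
  ultimately show ?case
    by (rule_tac controlled_mono) (auto simp: algebra_simps)
qed

lemma controlled_orbit_products_quadratic: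
  assumes z: "z \<in> carrier G" and \<Omega>: "finite \<Omega>" "\<Omega> \<subseteq> Cc_ball G"
  obtains M where "M \<ge> 1"
    "\<And>n p. p \<in> orbit_products G (Ad G z) \<Omega> n \<Longrightarrow> controlled (M * (real n + 1)\<^sup>2) p"
proof -
  \<comment> \<open>The individual constants are nonnegative, so their sum is a common one.\<close>
  have ex: "\<exists>K. \<forall>f\<in>\<Phi>. controlled K (lreg G f)" if fin: "finite \<Phi>" and "\<Phi> \<subseteq> Cc_ball G" for \<Phi>
  proof -
    have "\<forall>f\<in>\<Phi>. \<exists>K. controlled K (lreg G f)"
      using that controlled_lreg by blast
    then obtain K where K: "\<forall>f\<in>\<Phi>. controlled (K f) (lreg G f)" by metis
    then have "\<forall>f\<in>\<Phi>. K f \<le> (\<Sum>f\<in>\<Phi>. K f)"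
      using fin by (auto intro!: member_le_sum simp: controlled_def)
    with K show ?thesis by (blast intro: controlled_mono)
  qed
  obtain K0 where K0: "\<forall>f\<in>\<Omega>. controlled K0 (lreg G f)"
    using ex[OF \<Omega>] by blast
  \<comment> \<open>For empty \<open>\<Omega>\<close> nothing is known about \<open>K0\<close>,
    which could be negative.\<close>
  define K where "K = max 0 K0"
  have K: "K \<ge> 0" "\<And>f. f \<in> \<Omega> \<Longrightarrow> controlled K (lreg G f)"
    using K0 controlled_mono[of K0 _ K] by (auto simp: K_def)
  have "{delta z, delta (inv z), delta \<one>} \<subseteq> Cc_ball G"
    using z delta_in_Cc_ball by auto
  from ex[OF _ this] obtain L where L: "controlled L (lreg G (delta z))"
    "controlled L (lreg G (delta (inv z)))" "controlled L (lreg G (delta \<one>))"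
    by auto
  have "L \<ge> 0" using L by (simp add: controlled_def)
  show thesis
  proof
    show "1 + K + 2 * L \<ge> 1" using K \<open>L \<ge> 0\<close> by simp
    fix n p assume p: "p \<in> orbit_products G (Ad G z) \<Omega> n"
    have "controlled (L + real n * (K + 2 * real n * L)) p"
      using controlled_orbit_products[OF z L _ K(2,1) p] \<Omega> by (auto simp: Cc_ball_def)
    moreover have "L + real n * (K + 2 * real n * L) \<le> (1 + K + 2 * L) * (real n + 1)\<^sup>2"
    proof -
      \<comment> \<open>With this choice of \<open>M\<close> the difference is visibly a sum of
        nonnegative terms.\<close>
      have "(1 + K + 2 * L) * (real n + 1)\<^sup>2 - (L + real n * (K + 2 * real n * L))
          = (real n + 1)\<^sup>2 + K * ((real n)\<^sup>2 + real n + 1) + L * (4 * real n + 1)"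
        by (simp add: power2_eq_square algebra_simps)
      moreover have "\<dots> \<ge> 0" using K \<open>L \<ge> 0\<close> by simp
      ultimately show ?thesis by linarith
    qed
    ultimately show "controlled ((1 + K + 2 * L) * (real n + 1)\<^sup>2) p"
      by (rule controlled_mono)
  qed
qed


section \<open>Comparison of approximation dimensions\<close>

text \<open>Division by \<open>t\<close> moves \<open>Y\<close> into the open unit ball of the
  seminorm, hence the strict \<open>K ^ k < t\<close>. A subspace is closed under scaling, so one
  that approximates the ball within \<open>\<delta> / t\<close> approximates \<open>Y\<close> within
  \<open>\<delta>\<close>, and the infimum runs over a larger family.\<close>

lemma approx_dim_le_of_controlled:
  assumes Y: "\<And>y. y \<in> Y \<Longrightarrow> controlled K y" and t: "K ^ k < t" "t > 0"
  shows "approx_dim G Y \<delta> \<le> approx_dim G {a \<in> Cstar_red G. comm_seminorm G S k a < 1} (\<delta> / t)"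
  unfolding approx_dim_def
proof (rule INF_superset_mono)
  let ?N = "op_norm (ell2 G)" and ?L = "{a \<in> Cstar_red G. comm_seminorm G S k a < 1}"
  have unit: "op_scale (of_real (1 / t)) y \<in> ?L" if "y \<in> Y" for y
  proof -
    obtain f where f: "f \<in> Cc G" "y = lreg G f"
      using Y[OF \<open>y \<in> Y\<close>] by (auto simp: controlled_def)
    have eq: "op_scale (of_real (1 / t)) y = lreg G (\<lambda>x. of_real (1 / t) * f x)"
      using op_scale_lreg[OF f(1)] f(2) by simp
    have mem: "(\<lambda>x. of_real (1 / t) * f x) \<in> Cc G"
      by (rule Cc_scale) fact
    have "op_norm (Cc G) ((D ^^ k) y) \<le> ereal (K ^ k)"
      using Y[OF \<open>y \<in> Y\<close>] by (intro op_norm_leI) (auto simp: controlled_def)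
    then have "ereal (1 / t) * op_norm (Cc G) ((D ^^ k) y) \<le> ereal (1 / t) * ereal (K ^ k)"
      using t by (intro ereal_mult_left_mono) auto
    moreover have "comm_seminorm G S k (op_scale (of_real (1 / t)) y)
        \<le> ereal (1 / t) * op_norm (Cc G) ((D ^^ k) y)"
      using op_norm_scale_le[of "1 / t" "Cc G" "(D ^^ k) y"] t mem
      by (simp add: comm_seminorm_def eq D_pow_scale[symmetric] del: of_real_divide)
    moreover have "ereal (1 / t) * ereal (K ^ k) < 1"
      using t by (simp add: one_ereal_def)
    ultimately have "comm_seminorm G S k (op_scale (of_real (1 / t)) y) < 1"
      by (meson order_le_less_trans)
    then show ?thesis
      using lreg_in_Cstar_red[OF mem] unfolding eq by blast
  qed
  show "{Z. op.subspace Z \<and> Z \<subseteq> Cstar_red G \<and> (\<exists>B. finite B \<and> Z = op.span B) \<and>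
        (\<forall>y\<in>?L. \<exists>z\<in>Z. ?N (y - z) < ereal (\<delta> / t))}
    \<subseteq> {Z. op.subspace Z \<and> Z \<subseteq> Cstar_red G \<and> (\<exists>B. finite B \<and> Z = op.span B) \<and>
        (\<forall>y\<in>Y. \<exists>z\<in>Z. ?N (y - z) < ereal \<delta>)}"
  proof (intro Collect_mono impI, elim conjE, intro conjI ballI)
    fix Z y
    assume sub: "op.subspace Z"
      and approx: "\<forall>y\<in>?L. \<exists>z\<in>Z. ?N (y - z) < ereal (\<delta> / t)" and "y \<in> Y"
    from approx unit[OF \<open>y \<in> Y\<close>] obtain z where z: "z \<in> Z"
      "?N (op_scale (of_real (1 / t)) y - z) < ereal (\<delta> / t)" by blast
    have "y - op_scale (of_real t) z = op_scale (of_real t) (op_scale (of_real (1 / t)) y - z)"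
      using t by (auto simp: op_scale_def fun_eq_iff algebra_simps)
    then have "?N (y - op_scale (of_real t) z) \<le> ereal t * ?N (op_scale (of_real (1 / t)) y - z)"
      using op_norm_scale_le[of t] t by simp
    also have "\<dots> < ereal t * ereal (\<delta> / t)"
      using z(2) t by (intro ereal_mult_strict_left_mono) auto
    also have "\<dots> = ereal \<delta>" using t by simp
    finally show "\<exists>z\<in>Z. ?N (y - z) < ereal \<delta>"
      using op.subspace_scale[OF sub z(1)] by blast
  qed assumption+
qed simp

end

text \<open>The zero subspace cannot approximate an element of norm at least \<open>\<delta>\<close>
  within \<open>\<delta>\<close>.\<close>

lemma one_le_approx_dim:
  assumes "y \<in> Y" "ereal \<delta> \<le> op_norm (ell2 G) y"
  shows "1 \<le> approx_dim G Y \<delta>"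
  unfolding approx_dim_def
proof (rule INF_greatest, clarify)
  fix B :: "'a operator set"
  assume "finite B" "\<forall>y\<in>Y. \<exists>z\<in>op.span B. op_norm (ell2 G) (y - z) < ereal \<delta>"
  with assms obtain z where z: "z \<in> op.span B" "op_norm (ell2 G) (y - z) < ereal \<delta>"
    by blast
  with assms have "z \<noteq> 0" by auto
  obtain C where C: "C \<subseteq> op.span B" "\<not> op.dependent C" "op.span B \<subseteq> op.span C"
    "card C = op.dim (op.span B)"
    using op.basis_exists by blast
  \<comment> \<open>An infinite \<open>C\<close> would have \<open>card C = 0\<close>, which would
    not give a positive dimension.\<close>
  have "finite C"
    using op.independent_span_bound[OF \<open>finite B\<close> C(2,1)] by simp
  moreover have "C \<noteq> {}"
    using C(3) z(1) \<open>z \<noteq> 0\<close> by (auto simp: op.span_empty)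
  ultimately have "op.dim (op.span B) \<ge> 1"
    using C(4) by (metis Suc_leI One_nat_def card_gt_0_iff)
  then show "1 \<le> enat (op.dim (op.span B))"
    by (simp add: one_enat_def)
qed

section \<open>Logarithms of dimensions and the metric dimension\<close>

lemma elog_mono: "m \<le> n \<Longrightarrow> elog m \<le> elog n"
  by (cases m; cases n) (auto simp: elog_def)

lemma elog_nonneg: "1 \<le> n \<Longrightarrow> 0 \<le> elog n"
  using elog_mono[of 1 n] by (simp add: elog_def one_enat_def zero_ereal_def)

lemma elog_le_of_Mdim_less:
  assumes "Mdim G L < ereal c"
  shows "\<forall>\<^sub>F \<epsilon> in at_right 0.
    elog (approx_dim G {a \<in> Cstar_red G. L a < 1} \<epsilon>) \<le> ereal (c * ln (1 / \<epsilon>))"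
proof -
  \<comment> \<open>Below 1 the denominator \<open>ln (1 / \<epsilon>)\<close> is positive and the
    quotient can be multiplied out.\<close>
  have "\<forall>\<^sub>F \<epsilon> in at_right (0::real). \<epsilon> \<in> {0<..<1}"
    by (rule eventually_at_right_real) simp
  moreover have "\<forall>\<^sub>F \<epsilon> in at_right 0.
    elog (approx_dim G {a \<in> Cstar_red G. L a < 1} \<epsilon>) / ereal (ln (1 / \<epsilon>)) < ereal c"
    using assms unfolding Mdim_def by (rule Limsup_lessD)
  ultimately show ?thesis
  proof eventually_elim
    case (elim \<epsilon>)
    then have "ln (1 / \<epsilon>) > 0" by simp
    with elim(2) show ?case
      by (cases "elog (approx_dim G {a \<in> Cstar_red G. L a < 1} \<epsilon>)") (auto simp: field_simps)
  qed
qed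

section \<open>The upper bound for the entropy\<close>

context generated_group
begin

lemma Entp_at_le_zero:
  assumes z: "z \<in> carrier G" and \<Omega>: "finite \<Omega>" "\<Omega> \<subseteq> Cc_ball G" and "\<delta> > 0"
    and "k > 0" and fin: "Mdim G (comm_seminorm G S k) < \<infinity>"
  shows "Entp_at G (Ad G z) \<Omega> \<delta> \<le> 0"
proof -
  let ?D = "approx_dim G {a \<in> Cstar_red G. comm_seminorm G S k a < 1}"
  \<comment> \<open>Any finite exponent above the metric dimension serves, since only its product
    with \<open>ln n / n\<close> enters the limit.\<close>
  obtain c :: nat where "Mdim G (comm_seminorm G S k) < ereal (real c)"
    using fin less_PInf_Ex_of_nat by auto
  note ev = elog_le_of_Mdim_less[OF this]
  obtain M where M: "M \<ge> 1"
    "\<And>n p. p \<in> orbit_products G (Ad G z) \<Omega> n \<Longrightarrow> controlled (M * (real n + 1)\<^sup>2) p"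
    using controlled_orbit_products_quadratic[OF z \<Omega>] by blast
  \<comment> \<open>Twice the bound on the seminorm of the products, so that the comparison with
    \<open>t n\<close> is strict.\<close>
  define t where "t n = 2 * (M * (real n + 1)\<^sup>2) ^ k" for n :: nat
  \<comment> \<open>Together with \<open>k > 0\<close> this forces \<open>t n\<close> to infinity,
    so \<open>\<delta> / t n\<close> enters the range where the dimension estimate holds.\<close>
  have base: "M * (real n + 1)\<^sup>2 \<ge> real n + 1" for n
  proof -
    have "real n + 1 \<le> 1 * (real n + 1)\<^sup>2" by (simp add: power2_eq_square algebra_simps)
    also have "\<dots> \<le> M * (real n + 1)\<^sup>2" using M(1) by (intro mult_right_mono) auto
    finally show ?thesis .
  qed
  have t_ge: "t n \<ge> real n + 1" for n
  proof -
    have "M * (real n + 1)\<^sup>2 \<le> (M * (real n + 1)\<^sup>2) ^ k"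
      using base[of n] \<open>k > 0\<close> by (intro self_le_power) auto
    with base[of n] show ?thesis by (simp add: t_def)
  qed
  have t_pos: "t n > 0" for n using t_ge[of n] by linarith
  have t_gt: "(M * (real n + 1)\<^sup>2) ^ k < t n" for n
    using t_pos[of n] by (simp add: t_def)
  have "(\<lambda>n. \<delta> / t n) \<longlonglongrightarrow> 0"
  proof (rule tendsto_sandwich[OF always_eventually always_eventually tendsto_const])
    show "(\<lambda>n. \<delta> / (real n + 1)) \<longlonglongrightarrow> 0" by real_asymp
    show "\<forall>n. 0 \<le> \<delta> / t n" using t_pos \<open>\<delta> > 0\<close> by (simp add: less_imp_le)
    show "\<forall>n. \<delta> / t n \<le> \<delta> / (real n + 1)"
      using t_ge \<open>\<delta> > 0\<close> by (auto intro!: divide_left_mono mult_pos_pos t_pos)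
  qed
  then have "filterlim (\<lambda>n. \<delta> / t n) (at_right 0) sequentially"
    using t_pos \<open>\<delta> > 0\<close> by (intro tendsto_imp_filterlim_at_right) auto
  from eventually_compose_filterlim[OF ev this]
  have "\<forall>\<^sub>F n in sequentially. ereal (1 / real n) * elog (approx_dim G (orbit_products G (Ad G z) \<Omega> n) \<delta>)
      \<le> ereal (1 / real n * (real c * ((ln (2 / \<delta>) + real k * ln M) + 2 * real k * ln (real n + 1))))"
  proof eventually_elim
    case (elim n)
    have "elog (approx_dim G (orbit_products G (Ad G z) \<Omega> n) \<delta>) \<le> elog (?D (\<delta> / t n))"
      by (intro elog_mono approx_dim_le_of_controlled[OF M(2) t_gt t_pos])
    also note elim
    also have "ln (1 / (\<delta> / t n)) = ln ((2 / \<delta>) * (M * (real n + 1)\<^sup>2) ^ k)"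
      by (simp add: t_def)
    also have "\<dots> = ln (2 / \<delta>) + real k * (ln M + 2 * ln (real n + 1))"
      using M(1) \<open>\<delta> > 0\<close> by (subst ln_mult_pos) (auto simp: ln_realpow ln_mult_pos)
    finally have "ereal (1 / real n) * elog (approx_dim G (orbit_products G (Ad G z) \<Omega> n) \<delta>)
      \<le> ereal (1 / real n) * ereal (real c * (ln (2 / \<delta>) + real k * (ln M + 2 * ln (real n + 1))))"
      by (intro ereal_mult_left_mono) auto
    then show ?case by (simp add: algebra_simps)
  qed
  then have "Entp_at G (Ad G z) \<Omega> \<delta> \<le> limsup (\<lambda>n. ereal (1 / real n *
      (real c * ((ln (2 / \<delta>) + real k * ln M) + 2 * real k * ln (real n + 1)))))"
    unfolding Entp_at_def by (rule Limsup_mono)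
  also have "\<dots> = 0"
  proof (rule lim_imp_Limsup)
    \<comment> \<open>The constants are abstracted to \<open>a\<close> and \<open>b\<close>; what
      remains is that a logarithm divided by \<open>n\<close> vanishes.\<close>
    have "(\<lambda>n. 1 / real n * (real c * (a + b * ln (real n + 1)))) \<longlonglongrightarrow> 0" for a b
      by real_asymp
    then show "(\<lambda>n. ereal (1 / real n *
        (real c * ((ln (2 / \<delta>) + real k * ln M) + 2 * real k * ln (real n + 1))))) \<longlonglongrightarrow> 0"
      unfolding zero_ereal_def by (intro tendsto_ereal)
  qed simp
  finally show ?thesis .
qed

end

section \<open>The lower bound for the entropy\<close>

context group
begin

lemma orbit_products_one:
  assumes z: "z \<in> carrier G"
  shows "orbit_products G (Ad G z) {delta \<one>} n = {lreg G (delta \<one>)}"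
proof -
  have "induced (Ad G z) (delta \<one>) = delta \<one>"
    using z by (auto simp: induced_def supp_delta Ad_def fun_eq_iff) (simp_all add: delta_def)
  then have pow: "(induced (Ad G z) ^^ n) (delta \<one>) = delta \<one>" for n
    by (induction n) auto
  have d: "delta \<one> \<in> Cc G"
    by (simp add: delta_in_Cc)
  then have "lreg G (delta \<one>) \<circ> lreg G (delta \<one>) = lreg G (delta \<one>)"
    using Cc_subset_ell2[of G] by (auto simp: lreg_comp lreg_delta_one)
  then show ?thesis
    by (induction n) (auto simp: pow)
qed

text \<open>As \<open>elog 0\<close> is \<open>-\<infinity>\<close>, nonnegativity needs a witness:
  for the singleton of the unit and threshold 1, every orbit product is the unit, of norm at least
  1, so each dimension is at least 1.\<close>

lemma Entp_Ad_nonneg: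
  assumes z: "z \<in> carrier G"
  shows "0 \<le> Entp G (Ad G z)"
proof -
  have "delta \<one> \<in> ell2 G"
    using delta_in_Cc[OF one_closed] Cc_subset_ell2[of G] by blast
  then have "ereal 1 \<le> op_norm (ell2 G) (lreg G (delta \<one>))"
    using le_op_norm[of "delta \<one>" "ell2 G" "lreg G (delta \<one>)"] by (simp add: lreg_delta_one ell2_norm_delta)
  then have "1 \<le> approx_dim G (orbit_products G (Ad G z) {delta \<one>} n) 1" for n
    unfolding orbit_products_one[OF z] by (intro one_le_approx_dim) auto
  then have "limsup (\<lambda>_. 0 :: ereal) \<le> Entp_at G (Ad G z) {delta \<one>} 1"
    unfolding Entp_at_def
    by (intro Limsup_mono always_eventually allI ereal_0_le_mult elog_nonneg) simp_all
  then have "0 \<le> Entp_at G (Ad G z) {delta \<one>} 1"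
    by (simp add: Limsup_const)
  then show ?thesis
    unfolding Entp_def using delta_in_Cc_ball[OF one_closed]
    by (intro SUP_upper2[of "{delta \<one>}"] SUP_upper2[of 1]) auto
qed

end

theorem corollary3p14:
  fixes G :: "('a, 'b) monoid_scheme" and S :: "'a set"
    and r :: real and k :: nat and d :: ereal
  assumes "group G"
    and "finite S" and "S \<subseteq> carrier G" and "generate G S = carrier G"
    and "r > 0" and "rapid_decay G S r"
    and "real k > r"
    and "Mdim G (comm_seminorm G S k) = d" and "d < \<infinity>"
  shows "\<forall>z\<in>carrier G. Entp G (Ad G z) = 0"
proof
  fix z assume z: "z \<in> carrier G"
  interpret group G by fact
  interpret generated_group G S
    using assms by unfold_locales
  \<comment> \<open>The positivity of \<open>k\<close> comes from \<open>k > r > 0\<close>.\<close>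
  have "Entp G (Ad G z) \<le> 0"
    unfolding Entp_def using assms z
    by (intro SUP_least Entp_at_le_zero[where k = k]) auto
  then show "Entp G (Ad G z) = 0"
    using Entp_Ad_nonneg[OF z] by (rule antisym)
qed

end
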